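(* For all integers $q,r\ge 1$, on the random model $(\Omega_n,P_n)$, \[ \sqrt{n}\left(\frac{S_{q+r,n}}{S_{q,n}}-\frac{1}{4^r}\right)\Rightarrow N\left(0,\,\frac{4^r-1}{3\cdot 4^{2r-q+1}}\right)\qquad(n\to\infty), \] where $\Rightarrow$ denotes convergence in distribution and $N(\mu,\sigma^2)$ is the normal distribution with mean $\mu$ and variance $\sigma^2$.
   Context: For $n\ge 1$, let $\Omega_n$ be the set of rooted plane (ordered) full binary trees with $n$ leaves (every internal node has exactly two children, left and right distinguished). The random model is $\Omega_n$ with the uniform probability measure $P_n$. Horton–Strahler ordering: every leaf has order 1; an internal node whose two children have different orders $r_1\neq r_2$ has order $\max\{r_1,r_2\}$; an internal node whose two children both have order $r$ has order $r+1$. A branch of order $r$ is a maximal connected path consisting of nodes all of order $r$. For $\tau\in\Omega_n$, $S_{r,n}(\tau)$ denotes the number of branches of order $r$ in $\tau$. The ratio $S_{q+r,n}/S_{q,n}$ is taken to be $0$ when $S_{q,n}=0$. *)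

theory Defs
  imports "HOL-Probability.Probability"
begin

datatype fbtree = Leaf | Node fbtree fbtree

fun leaves :: "fbtree \<Rightarrow> nat" where
  "leaves Leaf = 1"
| "leaves (Node l r) = leaves l + leaves r"

definition Omega :: "nat \<Rightarrow> fbtree set" where
  "Omega n = {t. leaves t = n}"

fun hs_order :: "fbtree \<Rightarrow> nat" where
  "hs_order Leaf = 1"
| "hs_order (Node l r) =
     (if hs_order l = hs_order r then hs_order l + 1 else max (hs_order l) (hs_order r))"

text \<open>Number of order-r nodes which are children whose parent has a different order,
  i.e. topmost nodes of non-root branches of order r.\<close>
fun branch_tops :: "nat \<Rightarrow> fbtree \<Rightarrow> nat" where
  "branch_tops r Leaf = 0"
| "branch_tops r (Node l a) =
     branch_tops r l + branch_tops r a
     + (if hs_order l = r \<and> hs_order (Node l a) \<noteq> r then 1 else 0)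
     + (if hs_order a = r \<and> hs_order (Node l a) \<noteq> r then 1 else 0)"

text \<open>S r t: number of branches (maximal paths of order-r nodes) of order r in t;
  each branch is identified by its topmost node (the root, or a node whose parent has
  a different order).\<close>
definition S :: "nat \<Rightarrow> fbtree \<Rightarrow> nat" where
  "S r t = branch_tops r t + (if hs_order t = r then 1 else 0)"

definition ratio :: "nat \<Rightarrow> nat \<Rightarrow> fbtree \<Rightarrow> real" where
  "ratio q r t = (if S q t = 0 then 0 else real (S (q + r) t) / real (S q t))"

definition normal_measure :: "real \<Rightarrow> real \<Rightarrow> real measure" where
  "normal_measure mu v = density lborel (normal_density mu (sqrt v))"

end

theory Submission
  imports Defs "HOL-Computational_Algebra.Formal_Power_Series" "HOL-Real_Asymp.Real_Asymp"
begin

unbundle no vec_syntax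
unbundle fps_syntax

text \<open>
  Pruning a tree (deleting its leaves and contracting chains) lowers all Horton--Strahler orders by
  one, and the number of trees with \<open>n\<close> leaves over a given pruned tree depends only on the number
  \<open>k\<close> of leaves of the latter. Hence branch counts form a Markov chain, whose transition law from
  \<open>n\<close> to \<open>k\<close> is proportional to \<open>(n choose 2k) * d k\<close> with \<open>d k\<close> of order \<open>sqrt k\<close>.
  The law proportional to \<open>n choose 2k\<close> has the centred characteristic function
  \<open>cos (s/4) ^ n + (- i sin (s/4)) ^ n\<close>; since it concentrates at \<open>k = n/4\<close>, the slowly varying
  factor \<open>d k\<close> does not affect the limit. Iterating this one-step central limit theorem over
  characteristic functions and applying the Levy continuity theorem gives the result.
\<close>

section \<open>Horton pruning\<close>

lemma leaves_pos: "leaves t > 0"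
  by (induction t) auto

lemma finite_Omega: "finite (Omega n)"
proof (induction n rule: less_induct)
  case (less n)
  have "Omega n \<subseteq> insert Leaf ((\<lambda>(l, r). Node l r) ` ((\<Union>i<n. Omega i) \<times> (\<Union>i<n. Omega i)))"
  proof
    fix t assume "t \<in> Omega n"
    then show "t \<in> insert Leaf ((\<lambda>(l, r). Node l r) ` ((\<Union>i<n. Omega i) \<times> (\<Union>i<n. Omega i)))"
      using leaves_pos by (cases t) (auto simp: Omega_def image_iff)
  qed
  then show ?case
    by (rule finite_subset) (use less in auto)
qed

lemma Omega_nonempty: "n \<ge> 1 \<Longrightarrow> Omega n \<noteq> {}"
proof (induction n rule: dec_induct)
  case base
  have "Leaf \<in> Omega 1" by (simp add: Omega_def)
  then show ?case by auto
next
  case (step n)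
  then obtain t where "t \<in> Omega n" by auto
  then have "Node Leaf t \<in> Omega (Suc n)" by (simp add: Omega_def)
  then show ?case by auto
qed

lemma hs_order_pos: "hs_order t \<ge> 1"
  by (induction t) auto

text \<open>Only leaves have order 1 and every parent has order at least 2, so each leaf is a branch
  by itself. This anchors both limit inductions at the deterministic count \<open>n\<close>.\<close>

lemma S_1: "S 1 t = leaves t"
proof (induction t)
  case (Node l r)
  then show ?case
    using hs_order_pos[of l] hs_order_pos[of r] by (auto simp: S_def split: if_splits)
qed (simp add: S_def)

text \<open>Horton pruning: delete all leaves and contract the resulting chains.
  The value at a single leaf is junk.\<close>
fun prune :: "fbtree \<Rightarrow> fbtree" where
  "prune Leaf = Leaf"
| "prune (Node l r) =
     (if l = Leaf then prune r else if r = Leaf then prune l else Node (prune l) (prune r))"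

text \<open>A node with exactly one leaf child has the order of its other child, so contracting it
  is harmless. With two non-leaf children both orders drop by one, and the order rule is invariant
  under a common shift. The convention \<open>prune Leaf = Leaf\<close> sends
  \<open>Node Leaf Leaf\<close> to a leaf, from order 2 to order 1.\<close>

lemma hs_order_prune: "t \<noteq> Leaf \<Longrightarrow> hs_order t = Suc (hs_order (prune t))"
proof (induction t)
  case (Node l r)
  then show ?case
    using hs_order_pos[of "prune l"] hs_order_pos[of "prune r"] by (cases l; cases r) auto
qed simp

text \<open>Deleted leaves have order 1 and are never counted at order \<open>Suc q\<close>. A
  contracted node has the order of its surviving child, so a branch passes through it and no top
  appears or disappears.\<close>

lemma branch_tops_prune: "t \<noteq> Leaf \<Longrightarrow> q \<ge> 1 \<Longrightarrow> branch_tops (Suc q) t = branch_tops q (prune t)"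
proof (induction t)
  case (Node l r)
  have pos: "hs_order (prune l) \<ge> 1" "hs_order (prune r) \<ge> 1"
    using hs_order_pos by blast+
  show ?case
  proof (cases "l = Leaf \<or> r = Leaf")
    case True
    then show ?thesis
      using Node pos hs_order_prune[of l] hs_order_prune[of r] by (cases "l = Leaf"; cases "r = Leaf") auto
  next
    case False
    then show ?thesis
      using Node pos hs_order_prune[of l] hs_order_prune[of r] by auto
  qed
qed simp

lemma S_prune: "t \<noteq> Leaf \<Longrightarrow> q \<ge> 1 \<Longrightarrow> S (Suc q) t = S q (prune t)"
  by (simp add: S_def branch_tops_prune hs_order_prune)

lemma ratio_prune: "t \<noteq> Leaf \<Longrightarrow> q \<ge> 1 \<Longrightarrow> ratio (Suc q) r t = ratio q r (prune t)"
  by (simp add: ratio_def S_prune)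

section \<open>Counting trees and pruning fibres\<close>

definition leaf_gf :: "fbtree set \<Rightarrow> real fps" where
  "leaf_gf A = Abs_fps (\<lambda>n. real (card (A \<inter> Omega n)))"

lemma leaf_gf_nth: "leaf_gf A $ n = real (card (A \<inter> Omega n))"
  by (simp add: leaf_gf_def)

lemma leaf_gf_Un: "A \<inter> B = {} \<Longrightarrow> leaf_gf (A \<union> B) = leaf_gf A + leaf_gf B"
  by (rule fps_ext)
    (auto simp: leaf_gf_nth Int_Un_distrib2 finite_Omega intro!: card_Un_disjoint
      simp flip: of_nat_add)

lemma leaf_gf_Leaf: "leaf_gf {Leaf} = fps_X"
  by (rule fps_ext) (auto simp: leaf_gf_nth Omega_def fps_X_def)

lemma leaf_gf_Node: "leaf_gf ((\<lambda>(l, r). Node l r) ` (A \<times> B)) = leaf_gf A * leaf_gf B"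
proof (rule fps_ext)
  fix n
  have "(\<lambda>(l, r). Node l r) ` (A \<times> B) \<inter> Omega n
      = (\<lambda>(l, r). Node l r) ` (\<Union>i\<in>{0..n}. (A \<inter> Omega i) \<times> (B \<inter> Omega (n - i)))"
    by (auto simp: Omega_def image_iff)
  moreover have "inj_on (\<lambda>(l, r). Node l r) X" for X
    by (auto simp: inj_on_def)
  ultimately have "card ((\<lambda>(l, r). Node l r) ` (A \<times> B) \<inter> Omega n)
      = card (\<Union>i\<in>{0..n}. (A \<inter> Omega i) \<times> (B \<inter> Omega (n - i)))"
    by (simp add: card_image)
  also have "\<dots> = (\<Sum>i=0..n. card ((A \<inter> Omega i) \<times> (B \<inter> Omega (n - i))))"
    by (rule card_UN_disjoint) (auto simp: finite_Omega, auto simp: Omega_def)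
  finally show "leaf_gf ((\<lambda>(l, r). Node l r) ` (A \<times> B)) $ n = (leaf_gf A * leaf_gf B) $ n"
    by (simp add: leaf_gf_nth fps_mult_nth card_cartesian_product)
qed

text \<open>This is the Catalan recurrence. Splitting at the root gives
  \<open>T = fps_X + T * T\<close>, so \<open>D = 1 - 2 * T\<close> is a square root of
  \<open>1 - 4 * fps_X\<close>; its linear differential equation relates consecutive
  coefficients.\<close>

lemma card_Omega_Suc:
  assumes "n \<ge> 1"
  shows "real (n + 1) * real (card (Omega (n + 1))) = (4 * real n - 2) * real (card (Omega n))"
proof -
  define T where "T = leaf_gf UNIV"
  define D where "D = 1 - 2 * T"
  have "UNIV = {Leaf} \<union> (\<lambda>(l, r). Node l r) ` (UNIV \<times> UNIV)"
    by (auto simp: image_iff) (metis fbtree.exhaust)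
  then have "T = fps_X + T * T"
    unfolding T_def by (metis leaf_gf_Un leaf_gf_Leaf leaf_gf_Node disjoint_iff fbtree.distinct(1)
        singletonD imageE case_prod_beta)
  then have D2: "D * D = 1 - 4 * fps_X"
    unfolding D_def by algebra
  have "fps_deriv (D * D) = - 4"
    unfolding D2 by (simp add: fps_deriv_numeral)
  then have "2 * (D * fps_deriv D) = - 4"
    by (simp add: algebra_simps)
  \<comment> \<open>Multiplying \<open>D * fps_deriv D = - 2\<close> by \<open>D\<close> makes the
    equation linear, since \<open>D * D\<close> is known.\<close>
  then have "fps_const 2 * (D * D * fps_deriv D) = fps_const 2 * (- 2 * D)"
    unfolding numeral_fps_const[symmetric] by algebra
  then have "(D * D) * fps_deriv D = - 2 * D"
    by (simp only: mult_cancel_left fps_const_eq_0_iff) simp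
  then have "(1 - 4 * fps_X) * fps_deriv D = - 2 * D"
    by (simp add: D2)
  then have "((1 - 4 * fps_X) * fps_deriv D) $ n = (- 2 * D) $ n"
    by simp
  then have *: "real (n + 1) * D $ (n + 1) - 4 * (real n * D $ n) = - 2 * D $ n"
    using assms by (simp add: left_diff_distrib mult.assoc numeral_fps_const)
  have nth: "D $ m = - 2 * real (card (Omega m))" if "m \<ge> 1" for m
    using that by (simp add: D_def T_def leaf_gf_nth numeral_fps_const)
  show ?thesis
    using * assms by (simp add: nth algebra_simps)
qed

section \<open>Sizes of the pruning fibres\<close>

definition prune_fibre :: "fbtree \<Rightarrow> fbtree set" where
  "prune_fibre u = {t. t \<noteq> Leaf \<and> prune t = u}"

text \<open>A tree over \<open>u\<close> carries at each of the \<open>2 * leaves u - 1\<close>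
  nodes of \<open>u\<close> a chain of leaves attached left or right, contributing
  \<open>1 / (1 - 2 * fps_X)\<close>, and at each leaf of \<open>u\<close> a pair of leaves,
  contributing \<open>fps_X ^ 2\<close>. Hence only \<open>leaves u\<close> matters.\<close>

lemma leaf_gf_prune_fibre:
  "leaf_gf (prune_fibre u) * (1 - 2 * fps_X) ^ (2 * leaves u - 1) = fps_X ^ (2 * leaves u)"
proof (induction u)
  case Leaf
  let ?F = "prune_fibre Leaf"
  have "?F = (\<lambda>(l, r). Node l r) ` ({Leaf} \<times> {Leaf}) \<union>
      ((\<lambda>(l, r). Node l r) ` ({Leaf} \<times> ?F) \<union> (\<lambda>(l, r). Node l r) ` (?F \<times> {Leaf}))"
    (is "_ = ?A \<union> (?B \<union> ?C)")
  proof (intro set_eqI iffI)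
    fix t assume "t \<in> ?F"
    then show "t \<in> ?A \<union> (?B \<union> ?C)"
      by (cases t) (auto simp: prune_fibre_def image_iff split: if_splits)
  qed (auto simp: prune_fibre_def)
  moreover have "?A \<inter> (?B \<union> ?C) = {}" "?B \<inter> ?C = {}"
    by (auto simp: prune_fibre_def)
  ultimately have "leaf_gf ?F = fps_X * fps_X + (fps_X * leaf_gf ?F + leaf_gf ?F * fps_X)"
    by (metis leaf_gf_Un leaf_gf_Leaf leaf_gf_Node)
  then show ?case
    by (simp add: algebra_simps power2_eq_square)
next
  case (Node u v)
  let ?F = "prune_fibre (Node u v)"
  have "?F = (\<lambda>(l, r). Node l r) ` (prune_fibre u \<times> prune_fibre v) \<union>
      ((\<lambda>(l, r). Node l r) ` ({Leaf} \<times> ?F) \<union> (\<lambda>(l, r). Node l r) ` (?F \<times> {Leaf}))"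
    (is "_ = ?A \<union> (?B \<union> ?C)")
  proof (intro set_eqI iffI)
    fix t assume "t \<in> ?F"
    then show "t \<in> ?A \<union> (?B \<union> ?C)"
      by (cases t) (auto simp: prune_fibre_def image_iff split: if_splits)
  qed (auto simp: prune_fibre_def)
  moreover have "?A \<inter> (?B \<union> ?C) = {}" "?B \<inter> ?C = {}"
    by (auto simp: prune_fibre_def)
  ultimately have "leaf_gf ?F = leaf_gf (prune_fibre u) * leaf_gf (prune_fibre v)
      + (fps_X * leaf_gf ?F + leaf_gf ?F * fps_X)"
    by (metis leaf_gf_Un leaf_gf_Leaf leaf_gf_Node)
  then have eq: "leaf_gf ?F * (1 - 2 * fps_X) = leaf_gf (prune_fibre u) * leaf_gf (prune_fibre v)"
    by algebra
  \<comment> \<open>Successors make the truncated exponents add up: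
    \<open>2 * (k + l) - 1 = 1 + (2 * k - 1) + (2 * l - 1)\<close> for positive leaf counts.\<close>
  obtain a b where ab: "leaves u = Suc a" "leaves v = Suc b"
    using leaves_pos by (metis gr0_implies_Suc)
  have "leaf_gf ?F * (1 - 2 * fps_X) ^ (2 * leaves (Node u v) - 1)
      = leaf_gf ?F * (1 - 2 * fps_X)
        * ((1 - 2 * fps_X) ^ (2 * leaves u - 1) * (1 - 2 * fps_X) ^ (2 * leaves v - 1))"
    by (simp add: ab power_add mult_ac)
  also have "\<dots> = (leaf_gf (prune_fibre u) * (1 - 2 * fps_X) ^ (2 * leaves u - 1))
      * (leaf_gf (prune_fibre v) * (1 - 2 * fps_X) ^ (2 * leaves v - 1))"
    unfolding eq by (simp add: mult_ac)
  also have "\<dots> = fps_X ^ (2 * leaves (Node u v))"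
    unfolding Node.IH by (simp add: power_add distrib_left)
  finally show ?case .
qed

text \<open>A coefficient of \<open>fps_X ^ (2 * k) / (1 - 2 * fps_X) ^ (2 * k - 1)\<close>, read
  off from the negative binomial series.\<close>

lemma card_prune_fibre:
  assumes "leaves u = k"
  shows "real (card (prune_fibre u \<inter> Omega n))
    = (if n < 2 * k then 0 else real ((n - 2) choose (2 * k - 2)) * 2 ^ (n - 2 * k))"
proof -
  have k: "k \<ge> 1" using leaves_pos[of u] assms by simp
  let ?P = "(1 - fps_const 2 * fps_X :: real fps) ^ (2 * k - 1)"
  have unit: "?P * inverse ?P = 1"
    by (rule inverse_mult_eq_1') (simp add: fps_power_zeroth)
  have "leaf_gf (prune_fibre u) = leaf_gf (prune_fibre u) * ?P * inverse ?P"
    using unit by (simp add: mult.assoc)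
  also have "\<dots> = fps_X ^ (2 * k) * inverse ?P"
    using leaf_gf_prune_fibre[of u] assms by (simp add: numeral_fps_const)
  also have "inverse ?P = Abs_fps (\<lambda>j. of_nat ((2 * k - 1 + j - 1) choose j) * 2 ^ j)"
    using k by (intro one_minus_const_fps_X_neg_power') simp
  finally have *: "leaf_gf (prune_fibre u) $ n = (if n < 2 * k then 0
      else real ((2 * k - 1 + (n - 2 * k) - 1) choose (n - 2 * k)) * 2 ^ (n - 2 * k))"
    by (simp add: fps_X_power_mult_nth)
  have "(2 * k - 1 + (n - 2 * k) - 1) choose (n - 2 * k) = (n - 2) choose (2 * k - 2)"
    if "\<not> n < 2 * k"
  proof -
    have "2 * k - 1 + (n - 2 * k) - 1 = n - 2" "n - 2 * k = (n - 2) - (2 * k - 2)"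
      using that k by auto
    moreover have "2 * k - 2 \<le> n - 2"
      using that by simp
    ultimately show ?thesis
      by (metis binomial_symmetric)
  qed
  with * show ?thesis by (auto simp: leaf_gf_nth)
qed

lemma leaves_prune_le: "leaves (prune t) \<le> leaves t"
  by (induction t) auto

text \<open>Two absorption identities turn \<open>(n - 2) choose (2 * k - 2)\<close> into
  \<open>n choose (2 * k)\<close>. This separates a factor in \<open>n\<close> alone, which cancels
  on normalising, from a factor in \<open>k\<close> alone.\<close>

lemma card_prune_fibre_binomial:
  assumes "leaves u = k" "n \<ge> 2"
  shows "real (card (prune_fibre u \<inter> Omega n))
    = 2 ^ n / (real n * (real n - 1)) * (real (n choose (2 * k)) * (2 * real k * (2 * real k - 1) / 4 ^ k))"
proof (cases "n < 2 * k")
  case True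
  then show ?thesis
    using card_prune_fibre[OF assms(1), of n] by (simp add: binomial_eq_0)
next
  case False
  obtain j where j: "k = Suc j"
    using leaves_pos[of u] assms by (metis gr0_implies_Suc)
  obtain m where m: "n = Suc (Suc m)"
    using assms(2) by (metis Suc_le_D numeral_2_eq_2 Suc_le_mono)
  have "Suc (Suc (2 * j)) * (Suc (Suc m) choose Suc (Suc (2 * j))) = Suc (Suc m) * (Suc m choose Suc (2 * j))"
    by (rule Suc_times_binomial)
  then have "Suc (2 * j) * (Suc (Suc (2 * j)) * (Suc (Suc m) choose Suc (Suc (2 * j))))
      = Suc (Suc m) * (Suc (2 * j) * (Suc m choose Suc (2 * j)))"
    by (metis mult.left_commute)
  also have "\<dots> = Suc (Suc m) * (Suc m * (m choose (2 * j)))"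
    by (simp only: Suc_times_binomial)
  finally have "(2 * k - 1) * (2 * k * (n choose (2 * k))) = n * ((n - 1) * ((n - 2) choose (2 * k - 2)))"
    by (simp add: j m del: binomial_Suc_Suc)
  then have "real ((2 * k - 1) * (2 * k * (n choose (2 * k)))) = real (n * ((n - 1) * ((n - 2) choose (2 * k - 2))))"
    by simp
  then have absorb: "(2 * real k - 1) * (2 * real k * real (n choose (2 * k)))
      = real n * (real n - 1) * real ((n - 2) choose (2 * k - 2))"
    using j m by (simp only: of_nat_mult) (simp add: of_nat_diff del: binomial_Suc_Suc)
  have "(2::real) ^ n = 2 ^ (n - 2 * k + 2 * k)" using False by simp
  then have pow: "(2::real) ^ n / 4 ^ k = 2 ^ (n - 2 * k)"
    by (simp only: power_add power_mult) simp
  have "2 ^ n / (real n * (real n - 1)) * (real (n choose (2 * k)) * (2 * real k * (2 * real k - 1) / 4 ^ k))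
      = 2 ^ n / 4 ^ k / (real n * (real n - 1)) * ((2 * real k - 1) * (2 * real k * real (n choose (2 * k))))"
    by (simp add: mult_ac)
  also have "\<dots> = 2 ^ (n - 2 * k) * real ((n - 2) choose (2 * k - 2))"
    unfolding absorb pow using assms by simp
  finally show ?thesis
    using card_prune_fibre[OF assms(1), of n] False by simp
qed

section \<open>The transition law of pruning\<close>

lemma sum_Omega_prune:
  fixes f :: "fbtree \<Rightarrow> complex"
  assumes "n \<ge> 2"
  shows "(\<Sum>t\<in>Omega n. f (prune t))
    = (\<Sum>k\<le>n. \<Sum>u\<in>Omega k. of_nat (card (prune_fibre u \<inter> Omega n)) * f u)"
proof -
  let ?T = "\<Union>k\<le>n. Omega k"
  \<comment> \<open>The bare leaf, which \<open>prune_fibre\<close> excludes, is not in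
    \<open>Omega n\<close> because \<open>n \<ge> 2\<close>.\<close>
  have fib: "{t \<in> Omega n. prune t = u} = prune_fibre u \<inter> Omega n" for u
    using assms by (auto simp: prune_fibre_def Omega_def)
  have "(\<Sum>t\<in>Omega n. f (prune t)) = (\<Sum>u\<in>?T. \<Sum>t\<in>{t \<in> Omega n. prune t = u}. f (prune t))"
    by (rule sum.group[symmetric]) (auto simp: finite_Omega, auto simp: Omega_def leaves_prune_le)
  also have "\<dots> = (\<Sum>u\<in>?T. of_nat (card (prune_fibre u \<inter> Omega n)) * f u)"
    by (rule sum.cong) (simp_all add: flip: fib)
  also have "\<dots> = (\<Sum>k\<le>n. \<Sum>u\<in>Omega k. of_nat (card (prune_fibre u \<inter> Omega n)) * f u)"
    by (rule sum.UNION_disjoint) (auto simp: finite_Omega, auto simp: Omega_def)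
  finally show ?thesis .
qed

text \<open>The expectation under the uniform law. \<open>Omega 0\<close> is empty, so the average
  at 0 is 0 by division by zero.\<close>

definition tree_avg :: "nat \<Rightarrow> (fbtree \<Rightarrow> complex) \<Rightarrow> complex" where
  "tree_avg n f = (\<Sum>t\<in>Omega n. f t) / of_nat (card (Omega n))"

lemma tree_avg_cong: "(\<And>t. leaves t = n \<Longrightarrow> f t = g t) \<Longrightarrow> tree_avg n f = tree_avg n g"
  by (auto simp: tree_avg_def Omega_def intro!: sum.cong)

lemma tree_avg_cmult: "tree_avg n (\<lambda>t. c * f t) = c * tree_avg n f"
  by (simp add: tree_avg_def sum_distrib_left)

lemma card_Omega_pos: "n \<ge> 1 \<Longrightarrow> card (Omega n) > 0"
  using Omega_nonempty finite_Omega by (simp add: card_gt_0_iff)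

lemma tree_avg_const: "n \<ge> 1 \<Longrightarrow> tree_avg n (\<lambda>t. c) = c"
  using card_Omega_pos[of n] by (simp add: tree_avg_def)

lemma card_times_tree_avg: "of_nat (card (Omega n)) * tree_avg n f = (\<Sum>t\<in>Omega n. f t)"
  using finite_Omega[of n] by (auto simp: tree_avg_def card_eq_0_iff)

lemma norm_tree_avg_le:
  assumes "\<And>t. norm (f t) \<le> 1"
  shows "norm (tree_avg n f) \<le> 1"
proof -
  have "norm (\<Sum>t\<in>Omega n. f t) \<le> real (card (Omega n)) * 1"
    by (rule sum_norm_bound) (rule assms)
  then show ?thesis
    by (cases "card (Omega n) = 0") (simp_all add: tree_avg_def norm_divide divide_le_eq)
qed

text \<open>For \<open>n \<ge> 1\<close> this is the law of half of a fair binomial variable with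
  \<open>n\<close> trials, conditioned on being even.\<close>

definition even_binom :: "nat \<Rightarrow> nat \<Rightarrow> real" where
  "even_binom n k = 2 * real (n choose (2 * k)) / 2 ^ n"

text \<open>The factor of the fibre size in \<open>k\<close> alone, times the number of trees with
  \<open>k\<close> leaves; the factor 2 of \<open>2 * k\<close> has gone into
  \<open>even_binom\<close>.\<close>

definition tree_weight :: "nat \<Rightarrow> real" where
  "tree_weight k = real (card (Omega k)) * real k * (2 * real k - 1) / 4 ^ k"

text \<open>The number of leaves after pruning is an even binomial variable reweighted by
  a factor of order \<open>sqrt k\<close>; given that number, the pruned tree is uniform.\<close>
lemma tree_avg_prune:
  assumes n: "n \<ge> 2"
  shows "tree_avg n (\<lambda>t. f (prune t))
    = (\<Sum>k\<le>n. of_real (even_binom n k * tree_weight k) * tree_avg k f)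
      / of_real (\<Sum>k\<le>n. even_binom n k * tree_weight k)"
proof -
  \<comment> \<open>\<open>A\<close> gathers the factors that depend on \<open>n\<close> only; it
    cancels in the quotient.\<close>
  define A :: complex where "A = of_real (2 ^ n * 2 ^ n / (real n * (real n - 1)))"
  have A: "A \<noteq> 0" using n by (simp add: A_def)
  have sum_eq: "(\<Sum>t\<in>Omega n. f (prune t))
      = A * (\<Sum>k\<le>n. of_real (even_binom n k * tree_weight k) * tree_avg k f)" for f
  proof -
    have "(\<Sum>u\<in>Omega k. of_nat (card (prune_fibre u \<inter> Omega n)) * f u)
        = A * (of_real (even_binom n k * tree_weight k) * tree_avg k f)" for k
    proof -
      have "of_nat (card (prune_fibre u \<inter> Omega n)) = A * of_real (even_binom n k * (real k * (2 * real k - 1) / 4 ^ k))"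
        if "u \<in> Omega k" for u
      proof -
        have arith: "p * p / N * (2 * c / p * x) = p / N * (c * (2 * x))" if "p \<noteq> 0" for p N c x :: real
          using that by simp
        have "real (card (prune_fibre u \<inter> Omega n)) = 
           (2 ^ n * 2 ^ n / (real n * (real n - 1))) * (even_binom n k * (real k * (2 * real k - 1) / 4 ^ k))"
          unfolding even_binom_def
          by (subst arith) (use card_prune_fibre_binomial[of u k n] that n in \<open>simp_all add: Omega_def mult.assoc\<close>)
        then show ?thesis
          unfolding A_def of_real_mult[symmetric] by (metis of_real_of_nat_eq)
      qed
      then have "(\<Sum>u\<in>Omega k. of_nat (card (prune_fibre u \<inter> Omega n)) * f u)
        = A * of_real (even_binom n k * (real k * (2 * real k - 1) / 4 ^ k)) * (\<Sum>u\<in>Omega k. f u)"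
        by (simp add: sum_distrib_left)
      then show ?thesis
        by (simp add: card_times_tree_avg[symmetric] tree_weight_def)
    qed
    then show ?thesis
      by (simp add: sum_Omega_prune[OF n] sum_distrib_left)
  qed
  \<comment> \<open>The constant function 1 yields the normaliser. At \<open>k = 0\<close> its
    average is 0 instead of 1, but there the weight vanishes.\<close>
  have "tree_avg k (\<lambda>_. 1) = 1 \<or> tree_weight k = 0" for k
    by (cases "k = 0") (simp_all add: tree_avg_const tree_weight_def)
  then have "of_real (even_binom n k * tree_weight k) * tree_avg k (\<lambda>_. 1) = of_real (even_binom n k * tree_weight k)" for k
    by (metis mult.right_neutral mult_zero_left mult_zero_right of_real_0)
  then have "of_nat (card (Omega n)) = A * of_real (\<Sum>k\<le>n. even_binom n k * tree_weight k)"
    using sum_eq[of "\<lambda>_. 1"] by (simp only: of_real_sum sum_constant mult_1_right)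
  then show ?thesis
    using A by (simp add: tree_avg_def sum_eq)
qed

section \<open>Square-root growth of the weights\<close>

lemma tree_weight_Suc:
  assumes "k \<ge> 1"
  shows "tree_weight (Suc k) = tree_weight k * (1 + 1 / (2 * real k))"
proof -
  have "tree_weight (Suc k) = (real (k + 1) * real (card (Omega (k + 1)))) * (2 * real k + 1) / 4 ^ Suc k"
    by (simp add: tree_weight_def)
  also have "\<dots> = (4 * real k - 2) * real (card (Omega k)) * (2 * real k + 1) / 4 ^ Suc k"
    unfolding card_Omega_Suc[OF assms] ..
  also have "\<dots> = tree_weight k * (1 + 1 / (2 * real k))"
    using assms by (simp add: tree_weight_def field_simps)
  finally show ?thesis .
qed

lemma tree_weight_pos: "k \<ge> 1 \<Longrightarrow> tree_weight k > 0"
  using card_Omega_pos[of k] by (simp add: tree_weight_def)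

text \<open>With \<open>d = tree_weight\<close>, the sequence \<open>(d k)\<^sup>2 / k\<close> increases while
  \<open>(d k)\<^sup>2 / (2 k - 1)\<close> decreases.\<close>
lemma tree_weight_asymp:
  obtains L where "L > 0" "(\<lambda>k. tree_weight k / sqrt (real k)) \<longlonglongrightarrow> L"
proof -
  define u where "u k = tree_weight (Suc k) ^ 2 / real (Suc k)" for k
  define v where "v k = tree_weight (Suc k) ^ 2 / (2 * real k + 1)" for k
  have u_step: "u k \<le> u (Suc k)" and v_step: "v (Suc k) \<le> v k" for k
  proof -
    define y where "y = tree_weight (Suc k) ^ 2"
    define x where "x = real (Suc k)"
    have x: "x \<ge> 1" and y: "y \<ge> 0"
      by (auto simp: x_def y_def)
    have sq: "tree_weight (Suc (Suc k)) ^ 2 = y * (1 + 1 / (2 * x)) ^ 2"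
      by (subst tree_weight_Suc) (simp_all add: power_mult_distrib y_def x_def)
    \<comment> \<open>Here \<open>x * (1 + 1 / (2 * x)) ^ 2\<close> equals
      \<open>x + 1 + 1 / (4 * x)\<close>.\<close>
    have "1 / x \<le> (1 + 1 / (2 * x)) ^ 2 / (x + 1)"
      using x by (simp add: divide_simps power2_eq_square) (simp add: algebra_simps)
    from mult_left_mono[OF this y] have "y / x \<le> y * (1 + 1 / (2 * x)) ^ 2 / (x + 1)"
      by simp
    then show "u k \<le> u (Suc k)"
      unfolding u_def sq by (simp add: y_def x_def add.commute)
    \<comment> \<open>This amounts to
      \<open>(2 * x - 1) * (2 * x + 1) \<le> 4 * x ^ 2\<close>.\<close>
    have "(1 + 1 / (2 * x)) ^ 2 / (2 * x + 1) \<le> 1 / (2 * x - 1)"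
      using x by (simp add: divide_simps power2_eq_square) (simp add: algebra_simps)
    from mult_left_mono[OF this y] have "y * (1 + 1 / (2 * x)) ^ 2 / (2 * x + 1) \<le> y / (2 * x - 1)"
      by simp
    moreover have "2 * real (Suc k) + 1 = 2 * x + 1" "2 * real k + 1 = 2 * x - 1"
      by (simp_all add: x_def)
    ultimately show "v (Suc k) \<le> v k"
      unfolding v_def sq by (simp only: y_def)
  qed
  have "incseq u" "decseq v"
    using u_step v_step by (auto intro: incseq_SucI decseq_SucI)
  \<comment> \<open>The decreasing sequence bounds the increasing one, so the latter
    converges.\<close>
  have "u k \<le> 2 * v 0" for k
  proof -
    have "1 / real (Suc k) \<le> 2 * (1 / (2 * real k + 1))"
      by (simp add: field_simps)
    from mult_left_mono[OF this, of "tree_weight (Suc k) ^ 2"] have "u k \<le> 2 * v k"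
      by (simp add: u_def v_def mult.commute)
    also have "v k \<le> v 0" using \<open>decseq v\<close> by (auto simp: decseq_def)
    finally show ?thesis by simp
  qed
  then obtain M where M: "u \<longlonglongrightarrow> M" "\<And>i. u i \<le> M"
    using incseq_convergent[OF \<open>incseq u\<close>] by blast
  have "0 < u 0" using tree_weight_pos[of 1] by (simp add: u_def)
  then have "M > 0" using M(2)[of 0] by linarith
  have "(\<lambda>k. sqrt (u k)) \<longlonglongrightarrow> sqrt M"
    by (intro tendsto_real_sqrt M)
  moreover have "sqrt (u k) = tree_weight (Suc k) / sqrt (real (Suc k))" for k
    using tree_weight_pos[of "Suc k"] by (simp add: u_def real_sqrt_divide)
  ultimately have "(\<lambda>k. tree_weight (Suc k) / sqrt (real (Suc k))) \<longlonglongrightarrow> sqrt M"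
    by simp
  then have "(\<lambda>k. tree_weight k / sqrt (real k)) \<longlonglongrightarrow> sqrt M"
    by (rule LIMSEQ_imp_Suc)
  with \<open>M > 0\<close> show ?thesis by (intro that[of "sqrt M"]) auto
qed

section \<open>The even binomial law\<close>

text \<open>Averaging the binomial expansions at \<open>z\<close> and \<open>- z\<close> cancels the
  odd powers.\<close>

lemma sum_even_binomial:
  fixes z :: complex
  shows "(\<Sum>k\<le>n. of_nat (n choose (2 * k)) * z ^ (2 * k)) = ((1 + z) ^ n + (1 - z) ^ n) / 2"
proof -
  have "((1 + z) ^ n + (1 - z) ^ n) / 2 = (\<Sum>j\<le>n. of_nat (n choose j) * ((z ^ j + (- z) ^ j) / 2))"
  proof -
    have 1: "(1 + z) ^ n = (\<Sum>j\<le>n. of_nat (n choose j) * z ^ j)"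
      using binomial_ring[of z 1 n] by (simp add: add.commute)
    have 2: "(1 - z) ^ n = (\<Sum>j\<le>n. of_nat (n choose j) * (- z) ^ j)"
      using binomial_ring[of "- z" 1 n] by (simp add: add.commute)
    show ?thesis
      unfolding 1 2 by (simp add: sum_divide_distrib flip: sum.distrib)
        (simp add: field_simps)
  qed
  also have "\<dots> = (\<Sum>j\<in>{..2 * n}. of_nat (n choose j) * ((z ^ j + (- z) ^ j) / 2))"
    by (rule sum.mono_neutral_left) (auto simp: binomial_eq_0)
  also have "\<dots> = (\<Sum>j\<in>(\<lambda>k. 2 * k) ` {..n}. of_nat (n choose j) * ((z ^ j + (- z) ^ j) / 2))"
  proof (rule sum.mono_neutral_right)
    show "\<forall>i\<in>{..2 * n} - (*) 2 ` {..n}. of_nat (n choose i) * ((z ^ i + (- z) ^ i) / 2) = 0"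
    proof
      fix i assume i: "i \<in> {..2 * n} - (*) 2 ` {..n}"
      have "odd i"
      proof
        assume "even i"
        then obtain j where "i = 2 * j" by auto
        with i show False by auto
      qed
      then show "of_nat (n choose i) * ((z ^ i + (- z) ^ i) / 2) = 0" by simp
    qed
  qed auto
  also have "\<dots> = (\<Sum>k\<le>n. of_nat (n choose (2 * k)) * z ^ (2 * k))"
    by (subst sum.reindex) (auto simp: inj_on_def)
  finally show ?thesis by simp
qed

lemma even_binom_nonneg: "even_binom n k \<ge> 0"
  by (simp add: even_binom_def)

lemma sum_even_binom:
  assumes "n \<ge> 1"
  shows "(\<Sum>k\<le>n. even_binom n k) = 1"
proof -
  have "of_real (\<Sum>k\<le>n. even_binom n k) = 2 / 2 ^ n * (\<Sum>k\<le>n. of_nat (n choose (2 * k)) * (1::complex) ^ (2 * k))"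
    by (simp add: even_binom_def sum_distrib_left mult_ac)
  also have "\<dots> = 1"
    unfolding sum_even_binomial using assms by simp
  finally show ?thesis
    using of_real_eq_1_iff by blast
qed

text \<open>The even binomial sum is taken at \<open>z = cis (s / 2)\<close>. The centring factor
  \<open>cis (- s / 4) ^ n\<close> goes inside both \<open>n\<close>-th powers, where half-angle
  formulas leave a cosine and a sine; the sine term comes from the parity condition.\<close>

lemma even_binom_char:
  "(\<Sum>k\<le>n. of_real (even_binom n k) * cis (s * (real k - real n / 4)))
    = of_real (cos (s / 4)) ^ n + (- \<i> * of_real (sin (s / 4))) ^ n"
proof -
  have "(\<Sum>k\<le>n. of_real (even_binom n k) * cis (s * (real k - real n / 4)))
      = 2 / 2 ^ n * cis (- s / 4) ^ n * (\<Sum>k\<le>n. of_nat (n choose (2 * k)) * cis (s / 2) ^ (2 * k))"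
    unfolding sum_distrib_left
  proof (rule sum.cong)
    fix k
    have "cis (s * (real k - real n / 4)) = cis (- s / 4) ^ n * cis (s / 2) ^ (2 * k)"
    proof -
      have "s * (real k - real n / 4) = real n * (- s / 4) + real (2 * k) * (s / 2)"
        by (simp add: field_simps)
      then show ?thesis by (simp only: Complex.DeMoivre cis_mult)
    qed
    then show "of_real (even_binom n k) * cis (s * (real k - real n / 4))
        = 2 / 2 ^ n * cis (- s / 4) ^ n * (of_nat (n choose (2 * k)) * cis (s / 2) ^ (2 * k))"
      by (simp add: even_binom_def)
  qed simp
  also have "\<dots> = (cis (- s / 4) * (1 + cis (s / 2)) / 2) ^ n + (cis (- s / 4) * (1 - cis (s / 2)) / 2) ^ n"
  proof -
    have "2 / 2 ^ n * c ^ n * ((a ^ n + b ^ n) / 2) = (c * a / 2) ^ n + (c * b / 2) ^ n" for a b c :: complex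
      by (simp add: power_mult_distrib power_divide add_divide_distrib distrib_left)
    then show ?thesis unfolding sum_even_binomial by blast
  qed
  also have "cis (- s / 4) * (1 + cis (s / 2)) / 2 = of_real (cos (s / 4))"
    by (simp add: distrib_left cis_mult) (simp add: complex_eq_iff)
  also have "cis (- s / 4) * (1 - cis (s / 2)) / 2 = - \<i> * of_real (sin (s / 4))"
    by (simp add: right_diff_distrib cis_mult) (simp add: complex_eq_iff)
  finally show ?thesis .
qed

text \<open>The \<open>n\<close>-th powers of two numbers in the unit ball differ by at most
  \<open>n\<close> times their difference. Here \<open>cos w\<close> and the Gaussian differ by
  \<open>o(w^2)\<close>, while \<open>n * w^2 = y^2\<close> stays bounded. The general filter lets
  \<open>y\<close> vary with \<open>n\<close>.\<close>

lemma cos_power_tendsto: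
  fixes n :: "'b \<Rightarrow> nat" and y :: "'b \<Rightarrow> real"
  assumes n: "filterlim n at_top F" and y: "(y \<longlongrightarrow> y0) F"
  shows "((\<lambda>z. cos (y z / sqrt (real (n z))) ^ n z) \<longlongrightarrow> exp (- y0\<^sup>2 / 2)) F"
proof -
  define w where "w z = y z / sqrt (real (n z))" for z
  \<comment> \<open>At 0 the quotient is 0 by division by zero. This is also its limit, so
    \<open>\<rho>\<close> is continuous there.\<close>
  define \<rho> where "\<rho> u = (cos u - exp (- u\<^sup>2 / 2)) / u\<^sup>2" for u :: real
  have sqrt_n: "filterlim (\<lambda>z. sqrt (real (n z))) at_top F"
    by (intro filterlim_compose[OF sqrt_at_top] filterlim_compose[OF filterlim_real_sequentially] n)
  have w0: "(w \<longlongrightarrow> 0) F"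
    unfolding w_def by (rule real_tendsto_divide_at_top[OF y sqrt_n])
  have "(\<rho> \<longlongrightarrow> \<rho> 0) (at 0)"
    unfolding \<rho>_def by (simp, real_asymp)
  then have "isCont \<rho> 0"
    by (simp add: isCont_def)
  then have "((\<lambda>z. \<rho> (w z)) \<longlongrightarrow> \<rho> 0) F"
    by (rule isCont_tendsto_compose) (rule w0)
  then have "((\<lambda>z. (y z)\<^sup>2 * \<bar>\<rho> (w z)\<bar>) \<longlongrightarrow> y0\<^sup>2 * \<bar>\<rho> 0\<bar>) F"
    by (intro tendsto_intros y)
  then have lim: "((\<lambda>z. (y z)\<^sup>2 * \<bar>\<rho> (w z)\<bar>) \<longlongrightarrow> 0) F"
    by (simp add: \<rho>_def)
  have pos: "eventually (\<lambda>z. n z > 0) F"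
    using n eventually_gt_at_top[of 0] by (rule filterlim_iff[THEN iffD1, rule_format])
  have "((\<lambda>z. cos (w z) ^ n z - exp (- (w z)\<^sup>2 / 2) ^ n z) \<longlongrightarrow> 0) F"
  proof (rule Lim_null_comparison[OF _ lim])
    show "eventually (\<lambda>z. norm (cos (w z) ^ n z - exp (- (w z)\<^sup>2 / 2) ^ n z) \<le> (y z)\<^sup>2 * \<bar>\<rho> (w z)\<bar>) F"
      using pos
    proof eventually_elim
      case (elim z)
      have "norm (cos (w z) ^ n z - exp (- (w z)\<^sup>2 / 2) ^ n z)
          \<le> real (n z) * norm (cos (w z) - exp (- (w z)\<^sup>2 / 2))"
        by (rule norm_power_diff) auto
      also have "norm (cos (w z) - exp (- (w z)\<^sup>2 / 2)) = (w z)\<^sup>2 * \<bar>\<rho> (w z)\<bar>"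
        by (cases "w z = 0") (simp_all add: \<rho>_def abs_mult)
      also have "real (n z) * ((w z)\<^sup>2 * \<bar>\<rho> (w z)\<bar>) = (y z)\<^sup>2 * \<bar>\<rho> (w z)\<bar>"
        using elim by (simp add: w_def power_divide)
      finally show ?case .
    qed
  qed
  moreover have "((\<lambda>z. exp (- (w z)\<^sup>2 / 2) ^ n z) \<longlongrightarrow> exp (- y0\<^sup>2 / 2)) F"
  proof (rule Lim_transform_eventually)
    show "((\<lambda>z. exp (- (y z)\<^sup>2 / 2)) \<longlongrightarrow> exp (- y0\<^sup>2 / 2)) F"
      by (intro tendsto_intros y) simp
    show "eventually (\<lambda>z. exp (- (y z)\<^sup>2 / 2) = exp (- (w z)\<^sup>2 / 2) ^ n z) F"
      using pos by eventually_elim (simp add: w_def power_divide flip: exp_of_nat_mult)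
  qed
  ultimately have "((\<lambda>z. cos (w z) ^ n z) \<longlongrightarrow> exp (- y0\<^sup>2 / 2)) F"
    using tendsto_add by fastforce
  then show ?thesis by (simp add: w_def)
qed

text \<open>In \<open>even_binom_char\<close> the cosine power sees the argument
  \<open>y / 4\<close>, giving variance 1/16; the parity term is bounded by a sine that tends to
  0.\<close>

lemma even_binom_char_tendsto:
  fixes n :: "'b \<Rightarrow> nat" and y :: "'b \<Rightarrow> real"
  assumes n: "filterlim n at_top F" and y: "(y \<longlongrightarrow> y0) F"
  shows "((\<lambda>z. \<Sum>k\<le>n z. of_real (even_binom (n z) k) * cis (y z * (real k - real (n z) / 4) / sqrt (real (n z))))
    \<longlongrightarrow> of_real (exp (- y0\<^sup>2 / 32))) F"
proof -
  let ?w = "\<lambda>z. y z / 4 / sqrt (real (n z))"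
  have y4: "((\<lambda>z. y z / 4) \<longlongrightarrow> y0 / 4) F"
    by (intro tendsto_intros y) simp
  have cos: "((\<lambda>z. cos (?w z) ^ n z) \<longlongrightarrow> exp (- (y0 / 4)\<^sup>2 / 2)) F"
    by (rule cos_power_tendsto[OF n y4])
  have sqrt_n: "filterlim (\<lambda>z. sqrt (real (n z))) at_top F"
    by (intro filterlim_compose[OF sqrt_at_top] filterlim_compose[OF filterlim_real_sequentially] n)
  have "((\<lambda>z. \<bar>sin (?w z)\<bar>) \<longlongrightarrow> \<bar>sin 0\<bar>) F"
    by (intro tendsto_rabs isCont_tendsto_compose[OF isCont_sin] real_tendsto_divide_at_top[OF y4 sqrt_n])
  then have sin0: "((\<lambda>z. \<bar>sin (?w z)\<bar>) \<longlongrightarrow> 0) F" by simp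
  have pos: "eventually (\<lambda>z. n z > 0) F"
    using n eventually_gt_at_top[of 0] by (rule filterlim_iff[THEN iffD1, rule_format])
  have "((\<lambda>z. (- \<i> * of_real (sin (?w z))) ^ n z) \<longlongrightarrow> 0) F"
  proof (rule Lim_null_comparison[OF _ sin0])
    show "eventually (\<lambda>z. norm ((- \<i> * of_real (sin (?w z))) ^ n z) \<le> \<bar>sin (?w z)\<bar>) F"
      using pos
    proof eventually_elim
      case (elim z)
      have "\<bar>sin (?w z)\<bar> ^ n z \<le> \<bar>sin (?w z)\<bar> ^ 1"
        using elim by (intro power_decreasing) auto
      then show ?case by (simp add: norm_power norm_mult)
    qed
  qed
  with tendsto_of_real[OF cos]
  have "((\<lambda>z. of_real (cos (?w z) ^ n z) + (- \<i> * of_real (sin (?w z))) ^ n z)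
      \<longlongrightarrow> of_real (exp (- (y0 / 4)\<^sup>2 / 2)) + (0::complex)) F"
    by (intro tendsto_add)
  moreover have "(\<Sum>k\<le>n z. of_real (even_binom (n z) k) * cis (y z * (real k - real (n z) / 4) / sqrt (real (n z))))
      = of_real (cos (?w z) ^ n z) + (- \<i> * of_real (sin (?w z))) ^ n z" for z
    using even_binom_char[of "n z" "y z / sqrt (real (n z))"] by (simp add: mult.commute)
  ultimately show ?thesis
    by (simp add: power_divide)
qed

text \<open>A Chebyshev argument with \<open>1 - cos\<close> in place of the square: its mean at
  \<open>k / n - 1 / 4\<close> is the real part of a characteristic function, and tends to 0 by the
  previous limit with \<open>y = 1 / sqrt n\<close>.\<close>

lemma even_binom_concentration:
  assumes "\<delta> > 0"
  shows "(\<lambda>n. \<Sum>k | k \<le> n \<and> \<bar>real k / real n - 1 / 4\<bar> \<ge> \<delta>. even_binom n k) \<longlonglongrightarrow> 0"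
proof -
  \<comment> \<open>The cap keeps \<open>d\<close> between 0 and \<open>pi\<close>, where the cosine
    decreases.\<close>
  define d where "d = min \<delta> 1"
  have d: "0 < d" "d \<le> 1" "d \<le> \<delta>" using assms by (auto simp: d_def)
  have cosd: "cos d < 1"
    using cos_monotone_0_pi[of 0 d] d pi_gt3 by simp
  let ?c = "\<lambda>n. \<Sum>k\<le>n. of_real (even_binom n k) * cis (1 / sqrt (real n) * (real k - real n / 4) / sqrt (real n))"
  have "((\<lambda>n. 1 / sqrt (real n)) \<longlonglongrightarrow> 0)"
    by real_asymp
  from even_binom_char_tendsto[OF filterlim_ident this]
  have "?c \<longlonglongrightarrow> of_real (exp (- 0\<^sup>2 / 32))" .
  then have "(\<lambda>n. (1 - Re (?c n)) / (1 - cos d)) \<longlonglongrightarrow> (1 - Re (of_real (exp (- 0\<^sup>2 / 32)))) / (1 - cos d)"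
    using cosd by (intro tendsto_intros) auto
  then have lim: "(\<lambda>n. (1 - Re (?c n)) / (1 - cos d)) \<longlonglongrightarrow> 0"
    by simp
  show ?thesis
  proof (rule Lim_null_comparison[OF _ lim])
    show "\<forall>\<^sub>F n in sequentially. norm (\<Sum>k | k \<le> n \<and> \<bar>real k / real n - 1 / 4\<bar> \<ge> \<delta>. even_binom n k)
        \<le> (1 - Re (?c n)) / (1 - cos d)"
      using eventually_ge_at_top[of 1]
    proof eventually_elim
      case (elim n)
      let ?w = "\<lambda>k. real k / real n - 1 / 4"
      let ?A = "{k. k \<le> n \<and> \<bar>?w k\<bar> \<ge> \<delta>}"
      have w: "1 / sqrt (real n) * (real k - real n / 4) / sqrt (real n) = ?w k" for k
        using elim by (simp add: field_simps)
      have "(\<Sum>k\<in>?A. even_binom n k) * (1 - cos d) = (\<Sum>k\<in>?A. even_binom n k * (1 - cos d))"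
        by (rule sum_distrib_right)
      also have "\<dots> \<le> (\<Sum>k\<in>?A. even_binom n k * (1 - cos (?w k)))"
      proof (rule sum_mono)
        fix k assume k: "k \<in> ?A"
        then have "real k / real n \<le> 1" "real k / real n \<ge> 0" using elim by auto
        then have "\<bar>?w k\<bar> \<le> pi" using pi_gt3 by linarith
        moreover have "d \<le> \<bar>?w k\<bar>" using k d by auto
        ultimately have "cos \<bar>?w k\<bar> \<le> cos d"
          using d by (intro cos_monotone_0_pi_le) auto
        then show "even_binom n k * (1 - cos d) \<le> even_binom n k * (1 - cos (?w k))"
          by (intro mult_left_mono) (auto simp: even_binom_nonneg)
      qed
      also have "\<dots> \<le> (\<Sum>k\<le>n. even_binom n k * (1 - cos (?w k)))"
        by (rule sum_mono2) (auto simp: even_binom_nonneg)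
      also have "\<dots> = 1 - Re (?c n)"
        unfolding w using sum_even_binom[OF elim] by (simp add: right_diff_distrib sum_subtractf Re_sum)
      finally show ?case
        using cosd by (simp add: le_divide_eq even_binom_nonneg sum_nonneg)
    qed
  qed
qed

section \<open>Joint limits in size, pruned size and Fourier argument\<close>

text \<open>Limits are taken jointly in the size and the Fourier argument, because pruning rescales the
  argument by the random factor \<open>sqrt (k / n)\<close>.\<close>
abbreviation size_param_filter :: "real \<Rightarrow> (nat \<times> real) filter" where
  "size_param_filter t \<equiv> sequentially \<times>\<^sub>F nhds t"

text \<open>Limits along this filter are uniform over all \<open>k\<close> with \<open>k / n\<close>
  near 1/4, the range where \<open>even_binom n\<close> concentrates.\<close>

definition pruned_filter :: "real \<Rightarrow> (nat \<times> nat \<times> real) filter" where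
  "pruned_filter t = inf (filtercomap (\<lambda>(n, k, x). (n, x)) (size_param_filter t))
     (filtercomap (\<lambda>(n, k, x). real k / real n) (nhds (1 / 4)))"

lemma pruned_filter_lims:
  shows "filterlim (\<lambda>(n, k, x). (n, x)) (size_param_filter t) (pruned_filter t)"
    and "filterlim (\<lambda>(n, k, x). n) sequentially (pruned_filter t)"
    and "((\<lambda>(n, k, x). x) \<longlongrightarrow> t) (pruned_filter t)"
    and "((\<lambda>(n, k, x). real k / real n) \<longlongrightarrow> 1 / 4) (pruned_filter t)"
    and "filterlim (\<lambda>(n, k, x). k) sequentially (pruned_filter t)"
proof -
  let ?G = "pruned_filter t"
  show 1: "filterlim (\<lambda>(n, k, x). (n, x)) (size_param_filter t) ?G"
    unfolding pruned_filter_def by (rule filterlim_mono[OF filterlim_filtercomap order_refl inf_le1])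
  show ratio: "((\<lambda>(n, k, x). real k / real n) \<longlongrightarrow> 1 / 4) ?G"
    unfolding pruned_filter_def by (rule filterlim_mono[OF filterlim_filtercomap order_refl inf_le2])
  show n: "filterlim (\<lambda>(n, k, x). n) sequentially ?G"
    using filterlim_compose[OF filterlim_fst 1] by (simp add: case_prod_unfold)
  show "((\<lambda>(n, k, x). x) \<longlongrightarrow> t) ?G"
    using filterlim_compose[OF filterlim_snd 1] by (simp add: case_prod_unfold)
  \<comment> \<open>\<open>k\<close> is \<open>k / n\<close> times \<open>n\<close>: a positive
    limit times infinity.\<close>
  have "filterlim (\<lambda>z. (case z of (n, k, x) \<Rightarrow> real k / real n) * real (case z of (n, k, x) \<Rightarrow> n)) at_top ?G"
    by (rule filterlim_tendsto_pos_mult_at_top[OF ratio])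
      (simp, intro filterlim_compose[OF filterlim_real_sequentially n])
  moreover have "eventually (\<lambda>z. (case z of (n, k, x) \<Rightarrow> n) > 0) ?G"
    using n eventually_gt_at_top[of 0] by (rule filterlim_iff[THEN iffD1, rule_format])
  then have "eventually (\<lambda>z. (case z of (n, k, x) \<Rightarrow> real k / real n) * real (case z of (n, k, x) \<Rightarrow> n)
      = real (case z of (n, k, x) \<Rightarrow> k)) ?G"
    by eventually_elim auto
  ultimately have "filterlim (\<lambda>z. real (case z of (n, k, x) \<Rightarrow> k)) at_top ?G"
    using filterlim_cong[OF refl refl] by fast
  then show "filterlim (\<lambda>(n, k, x). k) sequentially ?G"
    by (simp only: filterlim_sequentially_iff_filterlim_real)
qed

text \<open>For \<open>k / n\<close> near 1/4 the terms are small by hypothesis. The other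
  \<open>k\<close> have vanishing total mass by \<open>even_binom_concentration\<close>, and there
  the bound \<open>B\<close> suffices.\<close>

lemma even_binom_mean_tendsto_0:
  fixes g :: "nat \<Rightarrow> nat \<Rightarrow> real \<Rightarrow> complex"
  assumes bound: "\<And>n k x. k \<le> n \<Longrightarrow> norm (g n k x) \<le> B"
    and lim: "((\<lambda>(n, k, x). g n k x) \<longlongrightarrow> 0) (pruned_filter t)"
  shows "((\<lambda>(n, x). \<Sum>k\<le>n. even_binom n k * norm (g n k x)) \<longlongrightarrow> 0) (size_param_filter t)"
proof (rule tendstoI)
  fix e :: real assume "e > 0"
  have B: "B \<ge> 0" using bound[of 0 0 0] norm_ge_zero order_trans by blast
  from tendstoD[OF lim, of "e / 2"] \<open>e > 0\<close>
  have "eventually (\<lambda>(n, k, x). norm (g n k x) < e / 2) (pruned_filter t)"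
    by (simp add: case_prod_unfold)
  then obtain Q R where Q: "eventually Q (size_param_filter t)" and R: "eventually R (nhds (1 / 4))"
    and QR: "\<And>n k x. Q (n, x) \<Longrightarrow> R (real k / real n) \<Longrightarrow> norm (g n k x) < e / 2"
    unfolding pruned_filter_def eventually_inf eventually_filtercomap by force
  from R obtain \<delta> where \<delta>: "\<delta> > 0" "\<And>y. \<bar>y - 1 / 4\<bar> < \<delta> \<Longrightarrow> R y"
    unfolding eventually_nhds_metric dist_real_def by auto
  let ?A = "\<lambda>n. {k. k \<le> n \<and> \<bar>real k / real n - 1 / 4\<bar> \<ge> \<delta>}"
  \<comment> \<open>The denominator has \<open>B + 1\<close> because \<open>B\<close> may be
    0.\<close>
  have "eventually (\<lambda>n. dist (\<Sum>k\<in>?A n. even_binom n k) 0 < e / (2 * (B + 1))) sequentially"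
    using \<open>e > 0\<close> B by (intro tendstoD[OF even_binom_concentration[OF \<delta>(1)]]) simp
  then have "eventually (\<lambda>n. n \<ge> 1 \<and> (\<Sum>k\<in>?A n. even_binom n k) < e / (2 * (B + 1))) sequentially"
    using eventually_ge_at_top[of 1]
    by eventually_elim (simp add: dist_real_def even_binom_nonneg sum_nonneg)
  then have "eventually (\<lambda>z. fst z \<ge> 1 \<and> (\<Sum>k\<in>?A (fst z). even_binom (fst z) k) < e / (2 * (B + 1)))
      (size_param_filter t)"
    using filterlim_fst filterlim_iff by fast
  with Q show "\<forall>\<^sub>F z in size_param_filter t.
      dist (case z of (n, x) \<Rightarrow> \<Sum>k\<le>n. even_binom n k * norm (g n k x)) 0 < e"
  proof eventually_elim
    case (elim z)
    obtain n x where z: "z = (n, x)" by (cases z)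
    have n: "n \<ge> 1" and tail: "(\<Sum>k\<in>?A n. even_binom n k) < e / (2 * (B + 1))"
      using elim z by auto
    have "(\<Sum>k\<le>n. even_binom n k * norm (g n k x))
        \<le> (\<Sum>k\<le>n. even_binom n k * (e / 2) + (if k \<in> ?A n then even_binom n k * B else 0))"
    proof (rule sum_mono)
      fix k assume k: "k \<in> {..n}"
      show "even_binom n k * norm (g n k x) \<le> even_binom n k * (e / 2) + (if k \<in> ?A n then even_binom n k * B else 0)"
      proof (cases "k \<in> ?A n")
        case True
        have "even_binom n k * norm (g n k x) \<le> even_binom n k * B"
          using bound[of k n x] k by (intro mult_left_mono) (auto simp: even_binom_nonneg)
        moreover have "even_binom n k * (e / 2) \<ge> 0"
          using \<open>e > 0\<close> by (simp add: even_binom_nonneg)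
        ultimately show ?thesis using True by simp
      next
        case False
        then have "norm (g n k x) \<le> e / 2"
          using QR[of n x k] \<delta>(2)[of "real k / real n"] elim(1) z k by auto
        from mult_left_mono[OF this even_binom_nonneg[of n k]] show ?thesis
          using False by (simp only: if_False)
      qed
    qed
    also have "\<dots> = e / 2 + (\<Sum>k\<in>?A n. even_binom n k) * B"
    proof -
      have "(\<Sum>k\<le>n. if k \<in> ?A n then even_binom n k * B else 0) = (\<Sum>k\<in>?A n. even_binom n k * B)"
        by (rule sum.mono_neutral_cong_right) auto
      then show ?thesis
        unfolding sum.distrib sum_distrib_right[symmetric] by (simp only: sum_even_binom[OF n] mult_1)
    qed
    also have "(\<Sum>k\<in>?A n. even_binom n k) * B \<le> (\<Sum>k\<in>?A n. even_binom n k) * (B + 1)"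
      by (intro mult_left_mono) (auto simp: even_binom_nonneg sum_nonneg)
    also have "\<dots> < e / 2"
      using tail B by (simp add: field_simps)
    finally have "(\<Sum>k\<le>n. even_binom n k * norm (g n k x)) < e" by simp
    moreover have "(\<Sum>k\<le>n. even_binom n k * norm (g n k x)) \<ge> 0"
      by (intro sum_nonneg) (simp add: even_binom_nonneg)
    ultimately show ?case by (simp add: z dist_real_def)
  qed
qed

section \<open>Limit theorems for branch counts\<close>

lemma tree_weight_0: "tree_weight 0 = 0"
  by (simp add: tree_weight_def)

lemma tree_weight_nonneg: "tree_weight k \<ge> 0"
  using tree_weight_pos[of k] tree_weight_0 by (cases "k = 0") auto

lemma tree_weight_le:
  obtains C where "\<And>k. tree_weight k \<le> C * sqrt (real k)"
proof -
  obtain L where L: "(\<lambda>k. tree_weight k / sqrt (real k)) \<longlonglongrightarrow> L"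
    using tree_weight_asymp by blast
  have "Bseq (\<lambda>k. tree_weight k / sqrt (real k))"
    by (rule convergent_imp_Bseq[OF convergentI[OF L]])
  then obtain C where C: "\<And>k. norm (tree_weight k / sqrt (real k)) \<le> C"
    by (rule BseqE) blast
  have "tree_weight k \<le> C * sqrt (real k)" for k
  proof (cases "k = 0")
    case False
    have "tree_weight k / sqrt (real k) \<le> C"
      using C[of k] tree_weight_nonneg[of k] by simp
    then show ?thesis using False by (simp add: divide_le_eq)
  qed (simp add: tree_weight_0)
  then show ?thesis by (rule that)
qed

text \<open>Near \<open>k = n / 4\<close> the rescaled weight times \<open>g\<close> is close to the
  constant \<open>L / 2 * l\<close>. Replacing it by that constant costs a null mean, since
  \<open>cis\<close> has norm 1, and leaves the characteristic function of the even binomial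
  law.\<close>

lemma weighted_even_binom_tendsto:
  fixes g :: "nat \<Rightarrow> nat \<Rightarrow> real \<Rightarrow> complex"
  assumes L: "(\<lambda>k. tree_weight k / sqrt (real k)) \<longlonglongrightarrow> L"
    and bound: "\<And>n k x. norm (g n k x) \<le> 1"
    and lim: "((\<lambda>(n, k, x). g n k x) \<longlongrightarrow> l) (pruned_filter t)"
  shows "((\<lambda>(n, x). \<Sum>k\<le>n. of_real (even_binom n k * (tree_weight k / sqrt (real n)))
      * (cis (a * x * (real k - real n / 4) / sqrt (real n)) * g n k x))
    \<longlongrightarrow> of_real (L / 2) * l * of_real (exp (- (a * t)\<^sup>2 / 32))) (size_param_filter t)"
proof -
  define h where "h n k = tree_weight k / sqrt (real n)" for n k :: nat
  define m where "m = of_real (L / 2) * l"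
  define c where "c n k x = cis (a * x * (real k - real n / 4) / sqrt (real n))" for n k :: nat and x :: real
  obtain C where C: "\<And>k. tree_weight k \<le> C * sqrt (real k)"
    using tree_weight_le by blast
  have C0: "C \<ge> 0" using C[of 1] tree_weight_pos[of 1] by simp
  have hC: "\<bar>h n k\<bar> \<le> C" if "k \<le> n" for n k
  proof (cases "n = 0")
    case False
    have "tree_weight k \<le> C * sqrt (real n)"
      using C[of k] C0 that by (smt (verit) mult_left_mono of_nat_mono real_sqrt_le_mono)
    then show ?thesis
      using False tree_weight_nonneg[of k] by (simp add: h_def divide_le_eq)
  qed (use C0 in \<open>simp add: h_def\<close>)
  \<comment> \<open>The factor \<open>sqrt (k / n)\<close>, with limit 1/2, converts the
    normalisation by \<open>sqrt k\<close> into one by \<open>sqrt n\<close>.\<close>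
  have "((\<lambda>z. (case z of (n, k, x) \<Rightarrow> tree_weight k / sqrt (real k)) * sqrt (case z of (n, k, x) \<Rightarrow> real k / real n))
      \<longlongrightarrow> L * sqrt (1 / 4)) (pruned_filter t)"
    using filterlim_compose[OF L pruned_filter_lims(5)]
    by (intro tendsto_intros pruned_filter_lims(4)) (simp add: case_prod_unfold)
  moreover have "(case z of (n, k, x) \<Rightarrow> tree_weight k / sqrt (real k)) * sqrt (case z of (n, k, x) \<Rightarrow> real k / real n)
      = (case z of (n, k, x) \<Rightarrow> h n k)" for z :: "nat \<times> nat \<times> real"
    by (cases z; cases "fst (snd z) = 0") (auto simp: h_def real_sqrt_divide tree_weight_0)
  ultimately have h: "((\<lambda>(n, k, x). h n k) \<longlongrightarrow> L / 2) (pruned_filter t)"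
    by (simp add: real_sqrt_divide)
  have "((\<lambda>z. of_real (case z of (n, k, x) \<Rightarrow> h n k) * (case z of (n, k, x) \<Rightarrow> g n k x) - m) \<longlongrightarrow> of_real (L / 2) * l - m) (pruned_filter t)"
    by (intro tendsto_intros h lim)
  then have "((\<lambda>(n, k, x). of_real (h n k) * g n k x - m) \<longlongrightarrow> 0) (pruned_filter t)"
    by (simp add: m_def case_prod_unfold)
  moreover have "norm (of_real (h n k) * g n k x - m) \<le> C + norm m" if "k \<le> n" for n k x
  proof -
    have "norm (of_real (h n k) * g n k x) \<le> C * 1"
      unfolding norm_mult using hC[OF that] bound[of n k x] C0 by (intro mult_mono) auto
    then show ?thesis
      using norm_triangle_ineq4[of "of_real (h n k) * g n k x" m] by simp
  qed
  ultimately have null: "((\<lambda>(n, x). \<Sum>k\<le>n. even_binom n k * norm (of_real (h n k) * g n k x - m)) \<longlongrightarrow> 0)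
      (size_param_filter t)"
    by (intro even_binom_mean_tendsto_0)
  have 1: "((\<lambda>(n, x). \<Sum>k\<le>n. of_real (even_binom n k) * (c n k x * (of_real (h n k) * g n k x - m))) \<longlongrightarrow> 0)
      (size_param_filter t)"
  proof (rule Lim_null_comparison[OF _ null], rule always_eventually, rule allI)
    fix z :: "nat \<times> real"
    obtain n x where z: "z = (n, x)" by (cases z)
    have "norm (\<Sum>k\<le>n. of_real (even_binom n k) * (c n k x * (of_real (h n k) * g n k x - m)))
        \<le> (\<Sum>k\<le>n. even_binom n k * norm (of_real (h n k) * g n k x - m))"
      by (rule sum_norm_le) (simp add: norm_mult c_def even_binom_nonneg)
    then show "norm (case z of (n, x) \<Rightarrow> \<Sum>k\<le>n. of_real (even_binom n k) * (c n k x * (of_real (h n k) * g n k x - m)))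
        \<le> (case z of (n, x) \<Rightarrow> \<Sum>k\<le>n. even_binom n k * norm (of_real (h n k) * g n k x - m))"
      by (simp add: z)
  qed
  have "((\<lambda>z. \<Sum>k\<le>fst z. of_real (even_binom (fst z) k)
        * cis ((a * snd z) * (real k - real (fst z) / 4) / sqrt (real (fst z))))
      \<longlongrightarrow> of_real (exp (- (a * t)\<^sup>2 / 32))) (size_param_filter t)"
    by (intro even_binom_char_tendsto filterlim_fst tendsto_mult tendsto_const filterlim_snd)
  then have 2: "((\<lambda>(n, x). \<Sum>k\<le>n. of_real (even_binom n k) * c n k x)
      \<longlongrightarrow> of_real (exp (- (a * t)\<^sup>2 / 32))) (size_param_filter t)"
    by (simp add: c_def case_prod_unfold)
  have "((\<lambda>z. (case z of (n, x) \<Rightarrow> \<Sum>k\<le>n. of_real (even_binom n k) * (c n k x * (of_real (h n k) * g n k x - m)))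
      + m * (case z of (n, x) \<Rightarrow> \<Sum>k\<le>n. of_real (even_binom n k) * c n k x))
      \<longlongrightarrow> 0 + m * of_real (exp (- (a * t)\<^sup>2 / 32))) (size_param_filter t)"
    by (intro tendsto_intros 1 2)
  moreover have "(case z of (n, x) \<Rightarrow> \<Sum>k\<le>n. of_real (even_binom n k) * (c n k x * (of_real (h n k) * g n k x - m)))
      + m * (case z of (n, x) \<Rightarrow> \<Sum>k\<le>n. of_real (even_binom n k) * c n k x)
    = (case z of (n, x) \<Rightarrow> \<Sum>k\<le>n. of_real (even_binom n k * h n k) * (c n k x * g n k x))" for z
    by (cases z) (simp add: sum_distrib_left algebra_simps flip: sum.distrib)
  ultimately show ?thesis
    by (simp add: m_def h_def c_def)
qed

lemma eventually_size_param_ge: "eventually (\<lambda>z. fst z \<ge> m) (size_param_filter t)"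
  using filterlim_fst eventually_ge_at_top[of m] by (rule filterlim_iff[THEN iffD1, rule_format])

text \<open>The normaliser is the same sum with \<open>a = 0\<close> and \<open>g = 1\<close>, so
  \<open>sqrt n\<close> and \<open>L / 2\<close> cancel in the quotient: the reweighting leaves no
  trace in the limit.\<close>

lemma pruned_mean_tendsto:
  fixes g :: "nat \<Rightarrow> nat \<Rightarrow> real \<Rightarrow> complex"
  assumes bound: "\<And>n k x. norm (g n k x) \<le> 1"
    and lim: "((\<lambda>(n, k, x). g n k x) \<longlongrightarrow> l) (pruned_filter t)"
  shows "((\<lambda>(n, x). (\<Sum>k\<le>n. of_real (even_binom n k * tree_weight k)
        * (cis (a * x * (real k - real n / 4) / sqrt (real n)) * g n k x))
      / of_real (\<Sum>k\<le>n. even_binom n k * tree_weight k))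
    \<longlongrightarrow> l * of_real (exp (- (a * t)\<^sup>2 / 32))) (size_param_filter t)"
proof -
  obtain L where L: "L > 0" "(\<lambda>k. tree_weight k / sqrt (real k)) \<longlonglongrightarrow> L"
    using tree_weight_asymp by blast
  let ?N = "\<lambda>a g (n, x). \<Sum>k\<le>n. of_real (even_binom n k * (tree_weight k / sqrt (real n)))
      * (cis (a * x * (real k - real n / 4) / sqrt (real n)) * g n k x)"
  have "((\<lambda>z. ?N a g z / ?N 0 (\<lambda>n k x. 1) z)
      \<longlongrightarrow> (of_real (L / 2) * l * of_real (exp (- (a * t)\<^sup>2 / 32)))
        / (of_real (L / 2) * 1 * of_real (exp (- (0 * t)\<^sup>2 / 32)))) (size_param_filter t)"
    using L(1)
    by (intro tendsto_divide weighted_even_binom_tendsto[OF L(2)] bound lim) (auto simp: case_prod_unfold)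
  moreover have "(of_real (L / 2) * l * of_real (exp (- (a * t)\<^sup>2 / 32)))
        / (of_real (L / 2) * 1 * of_real (exp (- (0 * t)\<^sup>2 / 32))) = l * of_real (exp (- (a * t)\<^sup>2 / 32))"
    using L(1) by simp
  moreover have "eventually (\<lambda>z. ?N a g z / ?N 0 (\<lambda>n k x. 1) z = (case z of (n, x) \<Rightarrow>
      (\<Sum>k\<le>n. of_real (even_binom n k * tree_weight k)
        * (cis (a * x * (real k - real n / 4) / sqrt (real n)) * g n k x))
      / of_real (\<Sum>k\<le>n. even_binom n k * tree_weight k))) (size_param_filter t)"
  proof -
    show ?thesis
      using eventually_size_param_ge[of 1 t]
    proof eventually_elim
      case (elim z)
      obtain n x where z: "z = (n, x)" by (cases z)
      define s where "s = complex_of_real (sqrt (real n))"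
      have s: "s \<noteq> 0" using elim z by (simp add: s_def)
      have N: "?N a g z = (\<Sum>k\<le>n. of_real (even_binom n k * tree_weight k)
        * (cis (a * x * (real k - real n / 4) / sqrt (real n)) * g n k x)) / s" for a g
        by (simp add: z s_def sum_divide_distrib)
      show ?case
        unfolding N[of a g] N[of 0 "\<lambda>n k x. 1"] using s by (simp add: z)
    qed
  qed
  ultimately show ?thesis
    using Lim_transform_eventually by fastforce
qed

text \<open>Induction by pruning once. With \<open>k\<close> leaves left, the deviation of the count
  from \<open>n / 4 ^ Suc r\<close> is that of the pruned tree from \<open>k / 4 ^ r\<close> plus
  \<open>(k - n / 4) / 4 ^ r\<close>. The first part is handled by the induction hypothesis, the
  second is the phase with \<open>a = 1 / 4 ^ r\<close>.\<close>

lemma branch_count_char_tendsto: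
  "((\<lambda>(n, x). tree_avg n (\<lambda>u. cis (x * (real (S (Suc r) u) - real n / 4 ^ r) / sqrt (real n))))
    \<longlongrightarrow> of_real (exp (- ((4 ^ r - 1) / (3 * 4 ^ (2 * r))) * t\<^sup>2 / 2))) (size_param_filter t)"
proof (induction r arbitrary: t)
  case 0
  have "eventually (\<lambda>z. 1 = (case z of (n, x) \<Rightarrow>
      tree_avg n (\<lambda>u. cis (x * (real (S (Suc 0) u) - real n / 4 ^ 0) / sqrt (real n))))) (size_param_filter t)"
    using eventually_size_param_ge[of 1 t]
  proof eventually_elim
    case (elim z)
    obtain n x where z: "z = (n, x)" by (cases z)
    have "tree_avg n (\<lambda>u. cis (x * (real (S (Suc 0) u) - real n / 4 ^ 0) / sqrt (real n))) = tree_avg n (\<lambda>u. 1)"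
      by (rule tree_avg_cong) (simp add: S_1[unfolded One_nat_def])
    then show ?case
      using elim z by (simp add: tree_avg_const)
  qed
  from Lim_transform_eventually[OF tendsto_const this] show ?case by simp
next
  case (Suc r)
  define \<phi> where "\<phi> k y = tree_avg k (\<lambda>u. cis (y * (real (S (Suc r) u) - real k / 4 ^ r) / sqrt (real k)))" for k y
  define v :: real where "v = (4 ^ r - 1) / (3 * 4 ^ (2 * r))"
  \<comment> \<open>Normalising by \<open>sqrt k\<close> instead of \<open>sqrt n\<close> rescales
    the argument by \<open>sqrt (k / n)\<close>, so the hypothesis is used at
    \<open>t / 2\<close>.\<close>
  have "filterlim (\<lambda>z. ((case z of (n, k, x) \<Rightarrow> k),
      (case z of (n, k, x) \<Rightarrow> x) * sqrt (case z of (n, k, x) \<Rightarrow> real k / real n)))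
    (size_param_filter (t * sqrt (1 / 4))) (pruned_filter t)"
    by (intro filterlim_Pair tendsto_intros pruned_filter_lims)
  from filterlim_compose[OF Suc.IH this]
  have lim: "((\<lambda>(n, k, x). \<phi> k (x * sqrt (real k / real n))) \<longlongrightarrow> of_real (exp (- v * (t / 2)\<^sup>2 / 2))) (pruned_filter t)"
    by (simp add: \<phi>_def v_def case_prod_unfold real_sqrt_divide)
  have bound: "norm (\<phi> k (x * sqrt (real k / real n))) \<le> 1" for n k x
    unfolding \<phi>_def by (rule norm_tree_avg_le) simp
  have eq: "eventually (\<lambda>z. (case z of (n, x) \<Rightarrow> (\<Sum>k\<le>n. of_real (even_binom n k * tree_weight k)
        * (cis (1 / 4 ^ r * x * (real k - real n / 4) / sqrt (real n)) * \<phi> k (x * sqrt (real k / real n))))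
      / of_real (\<Sum>k\<le>n. even_binom n k * tree_weight k)) = (case z of (n, x) \<Rightarrow>
      tree_avg n (\<lambda>u. cis (x * (real (S (Suc (Suc r)) u) - real n / 4 ^ Suc r) / sqrt (real n))))) (size_param_filter t)"
    using eventually_size_param_ge[of 2 t]
  proof eventually_elim
    case (elim z)
    obtain n x where z: "z = (n, x)" by (cases z)
    have n: "n \<ge> 2" using elim z by simp
    let ?f = "\<lambda>u. cis (x * (real (S (Suc r) u) - real n / 4 ^ Suc r) / sqrt (real n))"
    have avg: "tree_avg k ?f = cis (1 / 4 ^ r * x * (real k - real n / 4) / sqrt (real n)) * \<phi> k (x * sqrt (real k / real n))" for k
      unfolding \<phi>_def tree_avg_cmult[symmetric]
    proof (rule tree_avg_cong)
      fix u assume u: "leaves u = k"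
      then have k: "k > 0" using leaves_pos by blast
      have "x * sqrt (real k / real n) * (real (S (Suc r) u) - real k / 4 ^ r) / sqrt (real k)
          = x * (real (S (Suc r) u) - real k / 4 ^ r) / sqrt (real n)"
        using k by (simp add: real_sqrt_divide)
      then have "x * (real (S (Suc r) u) - real n / 4 ^ Suc r) / sqrt (real n)
        = 1 / 4 ^ r * x * (real k - real n / 4) / sqrt (real n)
          + x * sqrt (real k / real n) * (real (S (Suc r) u) - real k / 4 ^ r) / sqrt (real k)"
        by (simp add: add_divide_distrib diff_divide_distrib algebra_simps)
      then show "?f u = cis (1 / 4 ^ r * x * (real k - real n / 4) / sqrt (real n))
          * cis (x * sqrt (real k / real n) * (real (S (Suc r) u) - real k / 4 ^ r) / sqrt (real k))"
        by (simp only: cis_mult)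
    qed
    have "tree_avg n (\<lambda>u. cis (x * (real (S (Suc (Suc r)) u) - real n / 4 ^ Suc r) / sqrt (real n)))
        = tree_avg n (\<lambda>u. ?f (prune u))"
    proof (rule tree_avg_cong)
      fix u assume "leaves u = n"
      with n have "u \<noteq> Leaf" by auto
      then show "cis (x * (real (S (Suc (Suc r)) u) - real n / 4 ^ Suc r) / sqrt (real n)) = ?f (prune u)"
        by (simp add: S_prune)
    qed
    also have "\<dots> = (\<Sum>k\<le>n. of_real (even_binom n k * tree_weight k) * tree_avg k ?f)
      / of_real (\<Sum>k\<le>n. even_binom n k * tree_weight k)"
      by (rule tree_avg_prune[OF n])
    finally show ?case by (simp only: z prod.case avg)
  qed
  \<comment> \<open>The variance recursion: \<open>v / 4\<close> from the pruned tree plus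
    \<open>1 / (16 * 16 ^ r)\<close> from its random size.\<close>
  have "- v * (t / 2)\<^sup>2 / 2 + - (1 / 4 ^ r * t)\<^sup>2 / 32 = - ((4 ^ Suc r - 1) / (3 * 4 ^ (2 * Suc r))) * t\<^sup>2 / 2"
  proof -
    have "- ((p - 1) / (3 * p\<^sup>2)) * (t / 2)\<^sup>2 / 2 + - (1 / p * t)\<^sup>2 / 32
        = - ((4 * p - 1) / (3 * (16 * p\<^sup>2))) * t\<^sup>2 / 2" if "p \<noteq> 0" for p :: real
      using that by (simp add: divide_simps power2_eq_square) (simp add: algebra_simps)
    from this[of "4 ^ r"] show ?thesis
      by (simp add: v_def power_mult power2_eq_square flip: power_mult_distrib)
  qed
  then have "of_real (exp (- v * (t / 2)\<^sup>2 / 2)) * of_real (exp (- (1 / 4 ^ r * t)\<^sup>2 / 32))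
      = complex_of_real (exp (- ((4 ^ Suc r - 1) / (3 * 4 ^ (2 * Suc r))) * t\<^sup>2 / 2))"
    by (simp only: of_real_mult[symmetric] exp_add[symmetric])
  then show ?case
    using Lim_transform_eventually[OF pruned_mean_tendsto[OF bound lim, of "1 / 4 ^ r"] eq] by (simp only:)
qed

text \<open>For \<open>q = 1\<close> the denominator is \<open>n\<close>, so the branch count limit
  applies. Each further \<open>q\<close> prunes once: the centre \<open>1 / 4 ^ r\<close> does not
  depend on the size, so there is no phase (\<open>a = 0\<close>) and only the scale
  changes.\<close>

lemma ratio_char_tendsto:
  assumes "q \<ge> 1"
  shows "((\<lambda>(n, x). tree_avg n (\<lambda>u. cis (x * (sqrt (real n) * (ratio q r u - 1 / 4 ^ r)))))
    \<longlongrightarrow> of_real (exp (- (4 ^ (q - 1) * (4 ^ r - 1) / (3 * 4 ^ (2 * r))) * t\<^sup>2 / 2))) (size_param_filter t)"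
  using assms
proof (induction q arbitrary: t rule: dec_induct)
  case base
  have eq: "eventually (\<lambda>z. (case z of (n, x) \<Rightarrow>
      tree_avg n (\<lambda>u. cis (x * (real (S (Suc r) u) - real n / 4 ^ r) / sqrt (real n)))) = (case z of (n, x) \<Rightarrow>
      tree_avg n (\<lambda>u. cis (x * (sqrt (real n) * (ratio 1 r u - 1 / 4 ^ r)))))) (size_param_filter t)"
  proof (rule always_eventually, rule allI)
    fix z :: "nat \<times> real"
    obtain n x where z: "z = (n, x)" by (cases z)
    have "tree_avg n (\<lambda>u. cis (x * (real (S (Suc r) u) - real n / 4 ^ r) / sqrt (real n)))
      = tree_avg n (\<lambda>u. cis (x * (sqrt (real n) * (ratio 1 r u - 1 / 4 ^ r))))"
    proof (rule tree_avg_cong)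
      fix u assume u: "leaves u = n"
      then have n: "n > 0" using leaves_pos by blast
      have "ratio 1 r u = real (S (Suc r) u) / real n"
        using u n by (simp add: ratio_def S_1[unfolded One_nat_def])
      moreover have "sqrt (real n) * (real (S (Suc r) u) / real n - 1 / 4 ^ r)
        = (real (S (Suc r) u) - real n / 4 ^ r) / sqrt (real n)"
      proof -
        have "real (S (Suc r) u) - real n / 4 ^ r = real n * (real (S (Suc r) u) / real n - 1 / 4 ^ r)"
          using n by (simp add: right_diff_distrib)
        also have "\<dots> / sqrt (real n) = real n / sqrt (real n) * (real (S (Suc r) u) / real n - 1 / 4 ^ r)"
          by simp
        finally show ?thesis by (simp only: real_div_sqrt of_nat_0_le_iff)
      qed
      ultimately show "cis (x * (real (S (Suc r) u) - real n / 4 ^ r) / sqrt (real n))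
          = cis (x * (sqrt (real n) * (ratio 1 r u - 1 / 4 ^ r)))"
        by (simp only: times_divide_eq_right)
    qed
    then show "(case z of (n, x) \<Rightarrow>
      tree_avg n (\<lambda>u. cis (x * (real (S (Suc r) u) - real n / 4 ^ r) / sqrt (real n)))) = (case z of (n, x) \<Rightarrow>
      tree_avg n (\<lambda>u. cis (x * (sqrt (real n) * (ratio 1 r u - 1 / 4 ^ r)))))"
      by (simp add: z)
  qed
  show ?case
    using Lim_transform_eventually[OF branch_count_char_tendsto eq] by simp
next
  case (step q)
  define \<psi> where "\<psi> k y = tree_avg k (\<lambda>u. cis (y * (sqrt (real k) * (ratio q r u - 1 / 4 ^ r))))" for k y
  define v :: real where "v = 4 ^ (q - 1) * (4 ^ r - 1) / (3 * 4 ^ (2 * r))"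
  \<comment> \<open>Since \<open>sqrt n\<close> is \<open>sqrt k / sqrt (k / n)\<close>, the
    argument doubles in the limit.\<close>
  have "filterlim (\<lambda>z. ((case z of (n, k, x) \<Rightarrow> k),
      (case z of (n, k, x) \<Rightarrow> x) / sqrt (case z of (n, k, x) \<Rightarrow> real k / real n)))
    (size_param_filter (t / sqrt (1 / 4))) (pruned_filter t)"
    by (intro filterlim_Pair tendsto_intros pruned_filter_lims) simp
  from filterlim_compose[OF step.IH this]
  have lim: "((\<lambda>(n, k, x). \<psi> k (x / sqrt (real k / real n))) \<longlongrightarrow> of_real (exp (- v * (t * 2)\<^sup>2 / 2))) (pruned_filter t)"
    by (simp add: \<psi>_def v_def case_prod_unfold real_sqrt_divide)
  have bound: "norm (\<psi> k (x / sqrt (real k / real n))) \<le> 1" for n k x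
    unfolding \<psi>_def by (rule norm_tree_avg_le) simp
  have eq: "eventually (\<lambda>z. (case z of (n, x) \<Rightarrow> (\<Sum>k\<le>n. of_real (even_binom n k * tree_weight k)
        * (cis (0 * x * (real k - real n / 4) / sqrt (real n)) * \<psi> k (x / sqrt (real k / real n))))
      / of_real (\<Sum>k\<le>n. even_binom n k * tree_weight k)) = (case z of (n, x) \<Rightarrow>
      tree_avg n (\<lambda>u. cis (x * (sqrt (real n) * (ratio (Suc q) r u - 1 / 4 ^ r)))))) (size_param_filter t)"
    using eventually_size_param_ge[of 2 t]
  proof eventually_elim
    case (elim z)
    obtain n x where z: "z = (n, x)" by (cases z)
    have n: "n \<ge> 2" using elim z by simp
    let ?f = "\<lambda>u. cis (x * (sqrt (real n) * (ratio q r u - 1 / 4 ^ r)))"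
    have avg: "tree_avg k ?f = cis (0 * x * (real k - real n / 4) / sqrt (real n)) * \<psi> k (x / sqrt (real k / real n))" for k
      unfolding \<psi>_def tree_avg_cmult[symmetric]
    proof (rule tree_avg_cong)
      fix u assume u: "leaves u = k"
      then have k: "k > 0" using leaves_pos by blast
      have "x / sqrt (real k / real n) * (sqrt (real k) * (ratio q r u - 1 / 4 ^ r))
          = x * (sqrt (real n) * (ratio q r u - 1 / 4 ^ r))"
        using k by (simp add: real_sqrt_divide)
      then show "?f u = cis (0 * x * (real k - real n / 4) / sqrt (real n))
          * cis (x / sqrt (real k / real n) * (sqrt (real k) * (ratio q r u - 1 / 4 ^ r)))"
        by simp
    qed
    have "tree_avg n (\<lambda>u. cis (x * (sqrt (real n) * (ratio (Suc q) r u - 1 / 4 ^ r))))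
        = tree_avg n (\<lambda>u. ?f (prune u))"
    proof (rule tree_avg_cong)
      fix u assume "leaves u = n"
      with n have "u \<noteq> Leaf" by auto
      then show "cis (x * (sqrt (real n) * (ratio (Suc q) r u - 1 / 4 ^ r))) = ?f (prune u)"
        using step.hyps by (simp add: ratio_prune)
    qed
    also have "\<dots> = (\<Sum>k\<le>n. of_real (even_binom n k * tree_weight k) * tree_avg k ?f)
      / of_real (\<Sum>k\<le>n. even_binom n k * tree_weight k)"
      by (rule tree_avg_prune[OF n])
    finally show ?case by (simp only: z prod.case avg)
  qed
  \<comment> \<open>Doubling the argument quadruples the variance; \<open>q \<ge> 1\<close> makes
    \<open>Suc q - 1\<close> one more than \<open>q - 1\<close>.\<close>
  have "4 ^ (Suc q - 1) * (4 ^ r - 1) / (3 * 4 ^ (2 * r)) = 4 * v"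
    using step.hyps by (cases q) (simp_all add: v_def)
  then have "of_real (exp (- v * (t * 2)\<^sup>2 / 2)) * of_real (exp (- (0 * t)\<^sup>2 / 32))
      = complex_of_real (exp (- (4 ^ (Suc q - 1) * (4 ^ r - 1) / (3 * 4 ^ (2 * r))) * t\<^sup>2 / 2))"
    by (simp only:) (simp add: power_mult_distrib mult_ac)
  then show ?case
    using Lim_transform_eventually[OF pruned_mean_tendsto[OF bound lim, of 0] eq] by (simp only:)
qed

section \<open>Passage to the normal law\<close>

lemma char_normal_measure:
  assumes "v > 0"
  shows "char (normal_measure 0 v) x = of_real (exp (- v * x\<^sup>2 / 2))"
proof -
  interpret std: prob_space std_normal_distribution
    by (rule prob_space_normal_density) simp
  \<comment> \<open>The law is the image of the standard normal law under scaling by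
    \<open>sqrt v\<close>.\<close>
  have "distributed std_normal_distribution lborel (\<lambda>x. x) std_normal_density"
    by (simp add: distributed_def distr_id2)
  then have "distributed std_normal_distribution lborel (\<lambda>x. 0 + sqrt v * x)
      (normal_density (0 + sqrt v * 0) (\<bar>sqrt v\<bar> * 1))"
    by (rule std.normal_density_affine) (use assms in auto)
  then have "normal_measure 0 v = distr std_normal_distribution lborel (\<lambda>x. sqrt v * x)"
    using assms by (simp add: distributed_def normal_measure_def)
  then have "char (normal_measure 0 v) x = char std_normal_distribution (x * sqrt v)"
    unfolding char_def by (simp add: integral_distr mult.assoc)
  then show ?thesis
    using assms by (simp add: char_std_normal_distribution power_mult_distrib mult.commute)
qed

theorem theorem4:
  fixes q r :: nat
  assumes "q \<ge> 1" and "r \<ge> 1"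
  shows "weak_conv_m
           (\<lambda>n. measure_pmf (map_pmf
                  (\<lambda>t. sqrt (real n) * (ratio q r t - 1 / 4 ^ r))
                  (pmf_of_set (Omega n))))
           (normal_measure 0 ((4 ^ r - 1) / (3 * 4 powr (2 * real r - real q + 1))))"
proof -
  define v :: real where "v = 4 ^ (q - 1) * (4 ^ r - 1) / (3 * 4 ^ (2 * r))"
  \<comment> \<open>The exponent may be negative, so the power is regrouped as
    \<open>4 ^ (2 * r) / 4 ^ (q - 1)\<close>, with an exact subtraction as
    \<open>q \<ge> 1\<close>.\<close>
  have "2 * real r - real q + 1 = real (2 * r) - real (q - 1)"
    using assms by (simp add: of_nat_diff)
  then have "(4::real) powr (2 * real r - real q + 1) = 4 powr (real (2 * r) - real (q - 1))"
    by (simp only:)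
  also have "\<dots> = 4 ^ (2 * r) / 4 ^ (q - 1)"
    by (simp only: powr_diff powr_realpow zero_less_numeral)
  finally have v: "(4 ^ r - 1) / (3 * 4 powr (2 * real r - real q + 1)) = v"
    by (simp add: v_def)
  have "(4::real) ^ r > 1" using assms by simp
  then have v_pos: "v > 0" by (simp add: v_def)
  define X where "X n u = sqrt (real n) * (ratio q r u - 1 / 4 ^ r)" for n u
  \<comment> \<open>Levy continuity needs laws on the Borel sets, whereas every set is measurable
    for \<open>measure_pmf\<close>. Weak convergence only sees distribution functions, and these
    agree.\<close>
  define M where "M n = distr (measure_pmf (pmf_of_set (Omega n))) borel (X n)" for n
  have "weak_conv_m M (normal_measure 0 v)"
  proof (rule levy_continuity)
    show "real_distribution (M n)" for n
      unfolding M_def by (rule prob_space.real_distribution_distr[OF measure_pmf.prob_space_axioms]) simp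
    show "real_distribution (normal_measure 0 v)"
      unfolding real_distribution_def real_distribution_axioms_def normal_measure_def
      using v_pos by (simp add: prob_space_normal_density)
    show "(\<lambda>n. char (M n) x) \<longlonglongrightarrow> char (normal_measure 0 v) x" for x
    proof (rule Lim_transform_eventually)
      have "filterlim (\<lambda>n. (n, x)) (size_param_filter x) sequentially"
        by (intro filterlim_Pair filterlim_ident tendsto_const)
      from filterlim_compose[OF ratio_char_tendsto[OF assms(1), of r x] this]
      show "(\<lambda>n. tree_avg n (\<lambda>u. cis (x * X n u))) \<longlonglongrightarrow> char (normal_measure 0 v) x"
        unfolding char_normal_measure[OF v_pos] by (simp add: v_def X_def)
      \<comment> \<open>The size \<open>n = 0\<close> is left out: there is no uniform law on the
        empty \<open>Omega 0\<close>.\<close>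
      show "\<forall>\<^sub>F n in sequentially. tree_avg n (\<lambda>u. cis (x * X n u)) = char (M n) x"
        using eventually_ge_at_top[of 1]
      proof eventually_elim
        case (elim n)
        have "char (M n) x = integral\<^sup>L (measure_pmf (pmf_of_set (Omega n))) (\<lambda>u. cis (x * X n u))"
          by (simp add: char_def M_def integral_distr cis_conv_exp)
        also have "\<dots> = tree_avg n (\<lambda>u. cis (x * X n u))"
          using finite_Omega[of n] Omega_nonempty[OF elim]
          by (subst integral_measure_pmf[of "Omega n"])
            (auto simp: tree_avg_def scaleR_conv_of_real sum_divide_distrib intro!: sum.cong)
        finally show ?case by simp
      qed
    qed
  qed
  moreover have "cdf (M n) = cdf (measure_pmf (map_pmf (X n) (pmf_of_set (Omega n))))" for n
    by (simp add: cdf_def M_def measure_distr fun_eq_iff)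
  ultimately show ?thesis
    unfolding weak_conv_m_def v X_def by simp
qed

end
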